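(* Let $k\geq 1$ and $n\geq 2$ be integers, and let ${\boldsymbol s}=(1,k+1,2k+1,\ldots,(n-1)k+1)$, i.e. $s_i=(i-1)k+1$ for $1\le i\le n$. Let \[ L_{k,n}=\left\{\lambda\in\mathbb{Z}^n : 0\leq \frac{\lambda_1}{s_1}\leq \frac{\lambda_2}{s_2}\leq\cdots\leq\frac{\lambda_n}{s_n}\right\}. \] Then the Hilbert basis $\mathcal{H}_{k,n}$ of $L_{k,n}$ (equivalently, of the cone $\mathcal{C}_{k,n}=\{\lambda\in\mathbb{R}^n: 0\le \lambda_1/s_1\le\cdots\le\lambda_n/s_n\}$) consists exactly of the following elements: \begin{itemize} \item for each subset $A=\{a_1<a_2<\cdots<a_m\}\subseteq[n-2]=\{1,\ldots,n-2\}$ (including $A=\emptyset$), the vector $v_A=(0,0,\ldots,0,a_1,a_2,\ldots,a_m,a_m+1)\in\mathbb{Z}^n$ (so $v_\emptyset=(0,\ldots,0,1)$); \item every $w\in L_{k,n}$ with $w_{n-1}=(n-2)k+1$ and $w_n=(n-1)k+1$. \end{itemize}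
   Context: For a pointed rational cone $C\subseteq\mathbb{R}^n$, the Hilbert basis of $C$ is the unique minimal (with respect to inclusion) subset of $C\cap\mathbb{Z}^n$ that generates the semigroup $C\cap\mathbb{Z}^n$ under addition with nonnegative integer coefficients. Note $L_{k,n}=\mathcal{C}_{k,n}\cap\mathbb{Z}^n$. *)

theory Defs
  imports Complex_Main
begin

text \<open>
  A vector with coordinates indexed by 1, ..., n is a function on the naturals that vanishes
  outside that range, so that vectors of the same length add pointwise and equality is
  equality of coordinates.
\<close>

definition vectors :: "nat \<Rightarrow> (nat \<Rightarrow> 'a::zero) set" where
  "vectors n = {x. \<forall>i. i \<notin> {1..n} \<longrightarrow> x i = 0}"

definition vec_of_list :: "'a::zero list \<Rightarrow> nat \<Rightarrow> 'a" where
  "vec_of_list xs = (\<lambda>i. if i \<in> {1..length xs} then xs ! (i - 1) else 0)"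

definition integer_points :: "(nat \<Rightarrow> real) set \<Rightarrow> (nat \<Rightarrow> int) set" where
  "integer_points C = {x. (\<lambda>i. real_of_int (x i)) \<in> C}"

definition nat_combinations :: "(nat \<Rightarrow> int) set \<Rightarrow> (nat \<Rightarrow> int) set" where
  "nat_combinations H =
     {(\<lambda>i. \<Sum>h\<in>F. int (c h) * h i) | F (c :: (nat \<Rightarrow> int) \<Rightarrow> nat). finite F \<and> F \<subseteq> H}"

definition generates :: "(nat \<Rightarrow> int) set \<Rightarrow> (nat \<Rightarrow> int) set \<Rightarrow> bool" where
  "generates H M \<longleftrightarrow> H \<subseteq> M \<and> nat_combinations H = M"

definition minimal_generating_set :: "(nat \<Rightarrow> int) set \<Rightarrow> (nat \<Rightarrow> int) set \<Rightarrow> bool" where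
  "minimal_generating_set M H \<longleftrightarrow> generates H M \<and> (\<forall>H'. H' \<subset> H \<longrightarrow> \<not> generates H' M)"

text \<open>
  The predicate includes the uniqueness that makes the Hilbert basis well defined.
  It is stated for the semigroup; the Hilbert basis of a cone C is that of
  \<^term>\<open>integer_points C\<close>.
\<close>

definition is_hilbert_basis :: "(nat \<Rightarrow> int) set \<Rightarrow> (nat \<Rightarrow> int) set \<Rightarrow> bool" where
  "is_hilbert_basis M H \<longleftrightarrow>
     minimal_generating_set M H \<and> (\<forall>H'. minimal_generating_set M H' \<longrightarrow> H' = H)"

text \<open>Only indices i at least 1 are meant; the subtraction truncates at 0.\<close>

definition s_seq :: "nat \<Rightarrow> nat \<Rightarrow> nat" where
  "s_seq k i = (i - 1) * k + 1"

definition lecture_hall_cone :: "nat \<Rightarrow> nat \<Rightarrow> (nat \<Rightarrow> real) set" where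
  "lecture_hall_cone k n =
     {x \<in> vectors n. 0 \<le> x 1 / real (s_seq k 1) \<and>
        (\<forall>i\<in>{1..<n}. x i / real (s_seq k i) \<le> x (i + 1) / real (s_seq k (i + 1)))}"

definition lecture_hall_semigroup :: "nat \<Rightarrow> nat \<Rightarrow> (nat \<Rightarrow> int) set" where
  "lecture_hall_semigroup k n =
     {x \<in> vectors n. 0 \<le> real_of_int (x 1) / real (s_seq k 1) \<and>
        (\<forall>i\<in>{1..<n}. real_of_int (x i) / real (s_seq k i)
                      \<le> real_of_int (x (i + 1)) / real (s_seq k (i + 1)))}"

text \<open>
  The vector (0, ..., 0, a_1, ..., a_m, a_m + 1) of length n, where a_1 < ... < a_m are the
  elements of A; for empty A the last entry is 1, i.e. a_m is read as 0.
\<close>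

definition v_vec :: "nat \<Rightarrow> nat set \<Rightarrow> nat \<Rightarrow> int" where
  "v_vec n A = vec_of_list
     (replicate (n - (card A + 1)) 0 @ map int (sorted_list_of_set A)
       @ [(if A = {} then 0 else int (Max A)) + 1])"

lemma lecture_hall_semigroup_eq_integer_points:
  "lecture_hall_semigroup k n = integer_points (lecture_hall_cone k n)"
  by (simp add: lecture_hall_semigroup_def integer_points_def lecture_hall_cone_def vectors_def)

end

theory Submission imports Defs begin

text \<open>
  Irreducible elements lie in every generating set, so it suffices that the listed vectors are
  irreducible and generate. For v_A, irreducibility holds because the last difference
  x n - x (n - 1) is 1, while it is at least 1 on every nonzero point; for w it holds because
  x (n - 1) / s (n - 1) = x n / s n is forced on both summands and the two denominators are
  coprime.

  Generation is a greedy descent. If x (n - 1) is at least s (n - 1), subtract the pointwise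
  minimum of x and s. Otherwise integrality turns the inequalities on x into those for the
  sequence 0, 1, ..., n - 1, and one subtracts the v_A whose first n - 1 coordinates are
  min (x i) (i - 1).
\<close>

section \<open>Nonnegative integer combinations and Hilbert bases of additive monoids\<close>

lemma nat_combinations_zero: "(\<lambda>_. 0) \<in> nat_combinations H"
  unfolding nat_combinations_def by (rule CollectI, rule exI[of _ "{}"]) simp

lemma nat_combinations_add:
  assumes "x \<in> nat_combinations H" "h \<in> H"
  shows "(\<lambda>i. x i + h i) \<in> nat_combinations H"
proof -
  obtain F c where F: "finite F" "F \<subseteq> H" and x: "x = (\<lambda>i. \<Sum>g\<in>F. int (c g) * g i)"
    using assms(1) unfolding nat_combinations_def by blast
  \<comment> \<open>The values of \<open>c\<close> outside \<open>F\<close> are arbitrary, so they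
    are reset to 0 before the coefficient of \<open>h\<close> is raised by one; this covers
    \<open>h\<close> inside and outside \<open>F\<close> at once.\<close>
  define c' where "c' = (\<lambda>g. (if g \<in> F then c g else 0) + (if g = h then 1 else 0))"
  have "(\<Sum>g\<in>insert h F. int (c' g) * g i) = x i + h i" for i
  proof -
    have "(\<Sum>g\<in>insert h F. int (c' g) * g i)
        = (\<Sum>g\<in>insert h F. if g \<in> F then int (c g) * g i else 0)
          + (\<Sum>g\<in>insert h F. if g = h then g i else 0)"
      unfolding sum.distrib[symmetric] by (rule sum.cong) (auto simp: c'_def algebra_simps)
    moreover have "(\<Sum>g\<in>insert h F. if g \<in> F then int (c g) * g i else 0) = x i"
      unfolding x using F(1) by (intro sum.mono_neutral_cong_right) auto
    ultimately show ?thesis using F(1) by simp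
  qed
  then have "(\<lambda>i. x i + h i) = (\<lambda>i. \<Sum>g\<in>insert h F. int (c' g) * g i)" by simp
  moreover have "finite (insert h F)" "insert h F \<subseteq> H" using F assms(2) by auto
  ultimately show ?thesis unfolding nat_combinations_def by blast
qed

lemma nat_combinations_subset:
  assumes zero: "(\<lambda>_. 0) \<in> M"
    and add: "\<And>x y. x \<in> M \<Longrightarrow> y \<in> M \<Longrightarrow> (\<lambda>i. x i + y i) \<in> M"
    and "H \<subseteq> M"
  shows "nat_combinations H \<subseteq> M"
proof
  have scale: "(\<lambda>i. int m * h i) \<in> M" if "h \<in> M" for m h
  proof (induction m)
    case 0
    then show ?case using zero by simp
  next
    case (Suc m)
    from add[OF Suc that] show ?case by (simp add: algebra_simps)
  qed
  have "(\<lambda>i. \<Sum>g\<in>F. int (c g) * g i) \<in> M" if "finite F" "F \<subseteq> H" for F and c :: "(nat \<Rightarrow> int) \<Rightarrow> nat"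
    using that
  proof (induction F)
    case empty
    then show ?case using zero by simp
  next
    case (insert g F)
    have "(\<lambda>i. int (c g) * g i) \<in> M" using scale insert.prems assms(3) by blast
    from add[OF this insert.IH] insert.prems show ?case using insert.hyps by simp
  qed
  then show "x \<in> M" if "x \<in> nat_combinations H" for x
    using that unfolding nat_combinations_def by blast
qed

text \<open>In a representation of \<open>h\<close>, some nonzero generator \<open>g\<close> has a
  positive coefficient. Splitting off one copy of \<open>g\<close> leaves a remainder in
  \<open>M\<close>, and irreducibility forces that remainder to vanish, so
  \<open>h = g\<close>.\<close>

lemma irreducible_in_generators:
  assumes zero: "(\<lambda>_. 0) \<in> M"
    and add: "\<And>x y. x \<in> M \<Longrightarrow> y \<in> M \<Longrightarrow> (\<lambda>i. x i + y i) \<in> M"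
    and gen: "generates H M"
    and "h \<in> M" "h \<noteq> (\<lambda>_. 0)"
    and irr: "\<And>x y. x \<in> M \<Longrightarrow> y \<in> M \<Longrightarrow> h = (\<lambda>i. x i + y i) \<Longrightarrow> x = (\<lambda>_. 0) \<or> y = (\<lambda>_. 0)"
  shows "h \<in> H"
proof -
  have HM: "H \<subseteq> M" and nc: "nat_combinations H = M" using gen unfolding generates_def by auto
  obtain F c where F: "finite F" "F \<subseteq> H" and h: "h = (\<lambda>i. \<Sum>g\<in>F. int (c g) * g i)"
    using \<open>h \<in> M\<close> unfolding nc[symmetric] nat_combinations_def by blast
  obtain g where g: "g \<in> F" "c g > 0" "g \<noteq> (\<lambda>_. 0)"
  proof (rule ccontr)
    assume "\<not> thesis"
    then have "\<And>g. g \<in> F \<Longrightarrow> c g = 0 \<or> g = (\<lambda>_. 0)" using that by blast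
    then have "\<And>g i. g \<in> F \<Longrightarrow> int (c g) * g i = 0" by fastforce
    then have "h = (\<lambda>_. 0)" unfolding h by (intro ext sum.neutral) blast
    with assms(5) show False by simp
  qed
  define r where "r = (\<lambda>i. \<Sum>g'\<in>F. int ((c(g := c g - 1)) g') * g' i)"
  have "r \<in> M" unfolding nc[symmetric] nat_combinations_def r_def using F by blast
  moreover have "h = (\<lambda>i. g i + r i)"
  proof
    fix i
    have "h i = int (c g) * g i + (\<Sum>g'\<in>F - {g}. int (c g') * g' i)"
      unfolding h using F(1) g(1) by (simp add: sum.remove)
    moreover have "r i = int (c g - 1) * g i + (\<Sum>g'\<in>F - {g}. int (c g') * g' i)"
      unfolding r_def using F(1) g(1) by (simp add: sum.remove)
    ultimately show "h i = g i + r i" using g(2) by (simp add: of_nat_diff algebra_simps)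
  qed
  moreover have "g \<in> M" using g F HM by blast
  ultimately have "r = (\<lambda>_. 0)" using irr g(3) by blast
  with \<open>h = (\<lambda>i. g i + r i)\<close> have "h = g" by simp
  with g F show ?thesis by blast
qed

text \<open>Irreducibility puts \<open>H\<close> inside every generating set, and \<open>H\<close>
  itself generates. Being the least generating set yields both minimality and uniqueness.\<close>

lemma is_hilbert_basisI:
  assumes zero: "(\<lambda>_. 0) \<in> M"
    and add: "\<And>x y. x \<in> M \<Longrightarrow> y \<in> M \<Longrightarrow> (\<lambda>i. x i + y i) \<in> M"
    and "H \<subseteq> M" "M \<subseteq> nat_combinations H"
    and nz: "(\<lambda>_. 0) \<notin> H"
    and irr: "\<And>h x y. h \<in> H \<Longrightarrow> x \<in> M \<Longrightarrow> y \<in> M \<Longrightarrow> h = (\<lambda>i. x i + y i)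
                \<Longrightarrow> x = (\<lambda>_. 0) \<or> y = (\<lambda>_. 0)"
  shows "is_hilbert_basis M H"
proof -
  have least: "H \<subseteq> H'" if "generates H' M" for H'
  proof
    fix h assume h: "h \<in> H"
    then have "h \<in> M" "h \<noteq> (\<lambda>_. 0)" using assms(3) nz by auto
    from irreducible_in_generators[OF zero add that this irr[OF h]] show "h \<in> H'" .
  qed
  have "generates H M"
    unfolding generates_def using nat_combinations_subset[OF zero add] assms(3,4) by blast
  then show ?thesis
    unfolding is_hilbert_basis_def minimal_generating_set_def using least by blast
qed

lemma subset_nat_combinations_descent:
  fixes \<mu> :: "(nat \<Rightarrow> int) \<Rightarrow> nat"
  assumes step: "\<And>x. x \<in> M \<Longrightarrow> x \<noteq> (\<lambda>_. 0) \<Longrightarrow>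
      \<exists>h\<in>H. (\<lambda>i. x i - h i) \<in> M \<and> \<mu> (\<lambda>i. x i - h i) < \<mu> x"
  shows "M \<subseteq> nat_combinations H"
proof
  fix x assume "x \<in> M"
  then show "x \<in> nat_combinations H"
  proof (induction "\<mu> x" arbitrary: x rule: less_induct)
    case less
    show ?case
    proof (cases "x = (\<lambda>_. 0)")
      case True
      then show ?thesis by (simp add: nat_combinations_zero)
    next
      case False
      with step less.prems obtain h
        where h: "h \<in> H" "(\<lambda>i. x i - h i) \<in> M" "\<mu> (\<lambda>i. x i - h i) < \<mu> x" by blast
      from nat_combinations_add[OF less.hyps[OF h(3,2)] h(1)] show ?thesis by simp
    qed
  qed
qed

section \<open>Arithmetic of the sequence s and the lecture hall inequalities over the
  integers\<close>

lemma s_seq_pos [simp]: "s_seq k i > 0" "s_seq k i \<noteq> 0"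
  by (simp_all add: s_seq_def)

lemma s_seq_Suc: "i \<ge> 1 \<Longrightarrow> s_seq k (i + 1) = s_seq k i + k"
  by (cases i) (auto simp: s_seq_def)

text \<open>Consecutive terms differ by \<open>k\<close>, and every term is 1 modulo
  \<open>k\<close>.\<close>

lemma coprime_s_seq:
  assumes "i \<ge> 1"
  shows "coprime (s_seq k i) (s_seq k (i + 1))"
proof -
  have "coprime ((i - 1) * k + 1) k"
    by (metis coprime_1_left coprime_commute coprime_iff_gcd_eq_1 gcd_add_mult mult.commute add.commute)
  then show ?thesis
    unfolding s_seq_Suc[OF assms] coprime_iff_gcd_eq_1 gcd_add2 by (simp only: s_seq_def)
qed

text \<open>Cross-multiplication followed by s_{i+1} = s_i + k. The form with a difference on the
  right makes monotonicity, and comparison of the increments with \<open>k\<close>, directly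
  readable.\<close>

lemma lecture_hall_semigroup_iff:
  "x \<in> lecture_hall_semigroup k n \<longleftrightarrow> x \<in> vectors n \<and> 0 \<le> x 1 \<and>
     (\<forall>i\<in>{1..<n}. int k * x i \<le> int (s_seq k i) * (x (i + 1) - x i))"
proof -
  have "real_of_int (x i) / real (s_seq k i) \<le> real_of_int (x (i + 1)) / real (s_seq k (i + 1))
      \<longleftrightarrow> int k * x i \<le> int (s_seq k i) * (x (i + 1) - x i)" if "i \<in> {1..<n}" for i
  proof -
    have "real_of_int (x i) / real (s_seq k i) \<le> real_of_int (x (i + 1)) / real (s_seq k (i + 1))
      \<longleftrightarrow> real_of_int (x i * int (s_seq k (i + 1))) \<le> real_of_int (x (i + 1) * int (s_seq k i))"
      by (simp add: field_simps)
    also have "\<dots> \<longleftrightarrow> x i * int (s_seq k (i + 1)) \<le> x (i + 1) * int (s_seq k i)"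
      by (rule of_int_le_iff)
    also have "\<dots> \<longleftrightarrow> int k * x i \<le> int (s_seq k i) * (x (i + 1) - x i)"
      using that by (simp add: s_seq_Suc[simplified] algebra_simps)
    finally show ?thesis .
  qed
  then show ?thesis
    unfolding lecture_hall_semigroup_def by (auto simp: zero_le_divide_iff)
qed

section \<open>Consequences of the inequalities for a single lattice point\<close>

context
  fixes k n :: nat and x :: "nat \<Rightarrow> int"
  assumes x: "x \<in> lecture_hall_semigroup k n"
begin

lemma lecture_hall_outside: "i \<notin> {1..n} \<Longrightarrow> x i = 0"
  using x by (simp add: lecture_hall_semigroup_iff vectors_def)

lemma lecture_hall_step:
  "1 \<le> i \<Longrightarrow> i < n \<Longrightarrow> int k * x i \<le> int (s_seq k i) * (x (i + 1) - x i)"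
  using x by (simp add: lecture_hall_semigroup_iff)

lemma lecture_hall_nonneg: "0 \<le> x i"
proof (cases "i \<in> {1..n}")
  case True
  then have "1 \<le> i" "i \<le> n" by auto
  then show ?thesis
  proof (induction i rule: dec_induct)
    case base
    then show ?case using x by (simp add: lecture_hall_semigroup_iff)
  next
    case (step i)
    have "0 \<le> int (s_seq k i) * (x (i + 1) - x i)"
      using lecture_hall_step[of i] step by (smt (verit) Suc_leD Suc_le_lessD mult_nonneg_nonneg of_nat_0_le_iff)
    then have "x i \<le> x (i + 1)" by (simp add: zero_le_mult_iff)
    then show ?case using step by simp
  qed
qed (simp add: lecture_hall_outside)

lemma lecture_hall_mono_step: "1 \<le> i \<Longrightarrow> i < n \<Longrightarrow> x i \<le> x (i + 1)"
proof -
  assume i: "1 \<le> i" "i < n"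
  have "0 \<le> int (s_seq k i) * (x (i + 1) - x i)"
    using lecture_hall_step[OF i] lecture_hall_nonneg[of i] by (smt (verit) mult_nonneg_nonneg of_nat_0_le_iff)
  then show ?thesis by (simp add: zero_le_mult_iff)
qed

lemma lecture_hall_mono:
  assumes "1 \<le> i" "i \<le> j" "j \<le> n"
  shows "x i \<le> x j"
  using assms(2,3)
proof (induction j rule: dec_induct)
  case (step j)
  then show ?case using lecture_hall_mono_step[of j] assms(1) by (auto intro: order_trans)
qed simp

lemma lecture_hall_strict: "k \<ge> 1 \<Longrightarrow> 1 \<le> i \<Longrightarrow> i < n \<Longrightarrow> x i > 0 \<Longrightarrow> x i < x (i + 1)"
proof -
  assume i: "1 \<le> i" "i < n" and "k \<ge> 1" "x i > 0"
  then have "0 < int k * x i" by simp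
  then have "0 < int (s_seq k i) * (x (i + 1) - x i)"
    using lecture_hall_step[OF i] by linarith
  then show ?thesis by (simp add: zero_less_mult_iff)
qed

lemma lecture_hall_last_pos:
  assumes "x \<noteq> (\<lambda>_. 0)"
  shows "x n > 0"
proof -
  obtain i where i: "x i \<noteq> 0" using assms by auto
  then have "i \<in> {1..n}" using lecture_hall_outside by blast
  then show ?thesis
    using i lecture_hall_nonneg[of i] lecture_hall_mono[of i n] by force
qed

text \<open>The last difference is additive, so this bound rules out that a point with last
  difference 1 is a sum of two nonzero points. It also leaves room to subtract the last entry of a
  staircase vector.\<close>

lemma lecture_hall_last_difference:
  assumes "k \<ge> 1" "n \<ge> 2" "x \<noteq> (\<lambda>_. 0)"
  shows "x (n - 1) < x n"
proof (cases "x (n - 1) > 0")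
  case True
  then show ?thesis using lecture_hall_strict[of "n - 1"] assms by simp
next
  case False
  then show ?thesis using lecture_hall_last_pos[OF assms(3)] by simp
qed

text \<open>The ratios \<open>x i / s_seq k i\<close> are nondecreasing, so a ratio below 1 stays
  below 1 at all smaller indices. In integers: once \<open>x j\<close> reaches s_j, the next
  increment is at least \<open>k\<close>, hence \<open>x (j + 1)\<close> reaches s_{j+1}.\<close>

lemma lecture_hall_lt_s_seq:
  assumes "1 \<le> i" "i \<le> j" "j \<le> n" "x j < int (s_seq k j)"
  shows "x i < int (s_seq k i)"
  using assms(2-4)
proof (induction j rule: dec_induct)
  case (step j)
  have j: "1 \<le> j" "j < n" using assms(1) step by auto
  have "x j < int (s_seq k j)"
  proof (rule ccontr)
    assume "\<not> x j < int (s_seq k j)"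
    then have "int k * int (s_seq k j) \<le> int k * x j" by (simp add: mult_left_mono)
    also have "\<dots> \<le> int (s_seq k j) * (x (j + 1) - x j)" by (rule lecture_hall_step[OF j])
    finally have "int k \<le> x (j + 1) - x j" by (simp add: mult.commute)
    with \<open>\<not> x j < int (s_seq k j)\<close> step.prems show False
      using s_seq_Suc[OF j(1), of k] by simp
  qed
  then show ?case using step j by simp
qed simp

end

section \<open>Closure under addition and irreducibility of the vectors w\<close>

lemma lecture_hall_zero: "(\<lambda>_. 0) \<in> lecture_hall_semigroup k n"
  by (simp add: lecture_hall_semigroup_iff vectors_def)

lemma lecture_hall_add:
  assumes "x \<in> lecture_hall_semigroup k n" "y \<in> lecture_hall_semigroup k n"
  shows "(\<lambda>i. x i + y i) \<in> lecture_hall_semigroup k n"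
  using assms unfolding lecture_hall_semigroup_iff vectors_def
  by (force simp: algebra_simps)

text \<open>With s and t the last two terms of the sequence, t * x_{n-1} = s * x_n and coprimality
  make t divide x_n. As x_n lies between 0 and t, it is 0 or t, so one summand has last entry 0 and
  therefore vanishes.\<close>

lemma lecture_hall_w_irreducible:
  assumes "n \<ge> 2" "x \<in> lecture_hall_semigroup k n" "y \<in> lecture_hall_semigroup k n"
    and "x (n - 1) + y (n - 1) = int (s_seq k (n - 1))" "x n + y n = int (s_seq k n)"
  shows "x = (\<lambda>_. 0) \<or> y = (\<lambda>_. 0)"
proof -
  let ?s = "int (s_seq k (n - 1))" and ?t = "int (s_seq k n)"
  have n: "1 \<le> n - 1" "n - 1 < n" "n - 1 + 1 = n" using assms(1) by auto
  have t: "?t = ?s + int k" using s_seq_Suc[OF n(1), of k] n(3) by simp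
  have a: "?t * x (n - 1) \<le> ?s * x n" "?t * y (n - 1) \<le> ?s * y n"
    using lecture_hall_step[OF assms(2) n(1,2)] lecture_hall_step[OF assms(3) n(1,2)]
    unfolding n(3) t by (auto simp: algebra_simps)
  have "?t * x (n - 1) + ?t * y (n - 1) = ?s * x n + ?s * y n"
    unfolding distrib_left[symmetric] assms(4,5) by simp
  \<comment> \<open>The two inequalities in \<open>a\<close> add up to an equality, so each of them
    is an equality.\<close>
  with a have eq: "?t * x (n - 1) = ?s * x n" by linarith
  have "coprime ?t ?s" using coprime_s_seq[OF n(1), of k] n(3) by (simp add: coprime_commute)
  moreover have "?t dvd ?s * x n" using eq by (metis dvd_triv_left)
  ultimately have "?t dvd x n" by (simp add: coprime_dvd_mult_right_iff)
  then obtain q where q: "x n = ?t * q" by blast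
  have pos: "0 \<le> x n" "0 \<le> y n" using lecture_hall_nonneg assms(2,3) by blast+
  have tp: "?t > 0" by simp
  have "x n = 0 \<or> y n = 0"
  proof (cases "q \<le> 0")
    case True
    then show ?thesis using q pos tp by (smt (verit) mult_nonneg_nonpos)
  next
    case False
    then have "?t * 1 \<le> x n" unfolding q using tp by (intro mult_left_mono) auto
    then show ?thesis using pos assms(5) by linarith
  qed
  then show ?thesis
    using lecture_hall_last_pos[OF assms(2)] lecture_hall_last_pos[OF assms(3)] by force
qed

text \<open>The vectors v_A, described by inequalities between coordinates.\<close>

definition staircase :: "nat \<Rightarrow> (nat \<Rightarrow> int) \<Rightarrow> bool" where
  "staircase n h \<longleftrightarrow> h \<in> vectors n \<and> (\<forall>i. 0 \<le> h i) \<and>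
     (\<forall>i. 1 \<le> i \<longrightarrow> i + 1 < n \<longrightarrow> h i > 0 \<longrightarrow> h i < h (i + 1)) \<and>
     h (n - 1) \<le> int n - 2 \<and> h n = h (n - 1) + 1"

section \<open>Subsets of \<open>{1..n - 2}\<close> correspond to staircase vectors\<close>

text \<open>There are \<open>n - card A - 1\<close> leading zeros, and coordinates count from 1
  while lists count from 0, so the elements of \<open>A\<close> fill the coordinates from
  \<open>n - card A\<close> to \<open>n - 1\<close>.\<close>

lemma v_vec_nth:
  assumes "n \<ge> 2" "A \<subseteq> {1..n - 2}" "i < n"
  shows "v_vec n A i =
    (if i < n - card A then 0 else int (sorted_list_of_set A ! (i - (n - card A))))"
proof -
  have fin: "finite A" using assms(2) finite_subset by blast
  have "card A \<le> n - 2" using card_mono[OF _ assms(2)] by simp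
  then show ?thesis
    using assms(1,3) fin
    by (auto simp: v_vec_def vec_of_list_def nth_append vectors_def nth_Cons' Suc_diff_Suc
        intro!: arg_cong2[where f = nth])
qed

lemma v_vec_in_vectors:
  assumes "n \<ge> 2" "A \<subseteq> {1..n - 2}"
  shows "v_vec n A \<in> vectors n"
proof -
  have fin: "finite A" using assms(2) finite_subset by blast
  have "card A \<le> n - 2" using card_mono[OF _ assms(2)] by simp
  then show ?thesis
    using assms(1) fin by (auto simp: v_vec_def vec_of_list_def vectors_def)
qed

lemma v_vec_last:
  assumes "n \<ge> 2" "A \<subseteq> {1..n - 2}"
  shows "v_vec n A n = v_vec n A (n - 1) + 1"
proof -
  have fin: "finite A" using assms(2) finite_subset by blast
  have card: "card A \<le> n - 2" using card_mono[OF _ assms(2)] by simp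
  have last: "v_vec n A n = (if A = {} then 0 else int (Max A)) + 1"
    using assms(1) card fin by (auto simp: v_vec_def vec_of_list_def nth_append)
  show ?thesis
  proof (cases "A = {}")
    case True
    then show ?thesis using last v_vec_nth[OF assms, of "n - 1"] assms(1) by simp
  next
    case False
    then have m: "card A > 0" using fin by (simp add: card_gt_0_iff)
    let ?xs = "sorted_list_of_set A"
    have "Max A = ?xs ! (card A - 1)"
    proof (rule Max_eqI)
      show "?xs ! (card A - 1) \<in> A"
        using m fin by (metis diff_less length_sorted_list_of_set nth_mem set_sorted_list_of_set zero_less_one)
      fix a assume "a \<in> A"
      then obtain j where "j < card A" "a = ?xs ! j"
        using fin by (metis in_set_conv_nth length_sorted_list_of_set set_sorted_list_of_set)
      then show "a \<le> ?xs ! (card A - 1)"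
        by (auto intro!: sorted_nth_mono)
    qed (rule fin)
    moreover have "n - 1 - (n - card A) = card A - 1" using m card assms(1) by simp
    moreover have "\<not> n - 1 < n - card A" using m by linarith
    ultimately show ?thesis
      using last v_vec_nth[OF assms, of "n - 1"] assms(1) m False by simp
  qed
qed

lemma staircase_v_vec:
  assumes "n \<ge> 2" "A \<subseteq> {1..n - 2}"
  shows "staircase n (v_vec n A)"
proof -
  have fin: "finite A" using assms(2) finite_subset by blast
  have card: "card A \<le> n - 2" using card_mono[OF _ assms(2)] by simp
  let ?xs = "sorted_list_of_set A"
  have nn: "0 \<le> v_vec n A i" if "i < n" for i
    using v_vec_nth[OF assms that] by simp
  show ?thesis
    unfolding staircase_def
  proof (intro conjI allI impI)
    show "v_vec n A \<in> vectors n" by (rule v_vec_in_vectors[OF assms])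
    show last: "v_vec n A n = v_vec n A (n - 1) + 1" by (rule v_vec_last[OF assms])
    show "0 \<le> v_vec n A i" for i
    proof (cases "i < n")
      case False
      then show ?thesis
        using last nn[of "n - 1"] v_vec_in_vectors[OF assms] assms(1)
        by (cases "i = n") (auto simp: vectors_def)
    qed (rule nn)
    show "v_vec n A (n - 1) \<le> int n - 2"
    proof (cases "card A = 0")
      case True
      then show ?thesis using v_vec_nth[OF assms, of "n - 1"] assms(1) by simp
    next
      case False
      then have "n - 1 - (n - card A) < length ?xs" using card assms(1) by simp
      then have "?xs ! (n - 1 - (n - card A)) \<in> A"
        using fin by (metis nth_mem set_sorted_list_of_set)
      then have "?xs ! (n - 1 - (n - card A)) \<le> n - 2" using assms(2) by force
      then have "int (?xs ! (n - 1 - (n - card A))) \<le> int n - 2" using assms(1) by linarith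
      then show ?thesis using v_vec_nth[OF assms, of "n - 1"] assms(1) by simp
    qed
    fix i assume i: "1 \<le> i" "i + 1 < n" "0 < v_vec n A i"
    then have ge: "n - card A \<le> i" using v_vec_nth[OF assms, of i] by (auto split: if_splits)
    let ?j = "i - (n - card A)"
    have j: "i + 1 - (n - card A) = ?j + 1" "?j + 1 < length ?xs" using ge i card by auto
    then have "?xs ! ?j < ?xs ! (?j + 1)"
      by (intro sorted_wrt_nth_less[OF strict_sorted_list_of_set]) auto
    then show "v_vec n A i < v_vec n A (i + 1)"
      using v_vec_nth[OF assms, of i] v_vec_nth[OF assms, of "i + 1"] i ge j by simp
  qed
qed

text \<open>Going down from the bound at \<open>n - 1\<close>, each step below a positive entry
  loses at least 1; a zero entry satisfies the bound because \<open>1 \<le> i\<close>.\<close>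

lemma staircase_le:
  assumes "staircase n h" "1 \<le> i" "i < n"
  shows "h i \<le> int i - 1"
proof -
  have "i \<le> n - 1" using assms by simp
  then show ?thesis
    using assms(2)
  proof (induction i rule: inc_induct)
    case base
    then show ?case using assms unfolding staircase_def by (simp add: of_nat_diff)
  next
    case (step i)
    then have "0 < h i \<longrightarrow> h i < h (i + 1)" using assms(1) unfolding staircase_def by auto
    then show ?case using step by force
  qed
qed

text \<open>The set is recovered as the positive values among the first \<open>n - 1\<close>
  coordinates. They increase strictly, so sorting this set returns them in their original
  order.\<close>

lemma v_vec_if_staircase:
  assumes "n \<ge> 2" "staircase n h"
  shows "\<exists>A. A \<subseteq> {1..n - 2} \<and> h = v_vec n A"
proof -
  have vec: "h \<in> vectors n" and nn: "\<And>i. 0 \<le> h i" and hn: "h n = h (n - 1) + 1"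
    and incr: "\<And>i. 1 \<le> i \<Longrightarrow> i + 1 < n \<Longrightarrow> h i > 0 \<Longrightarrow> h i < h (i + 1)"
    using assms(2) unfolding staircase_def by auto
  \<comment> \<open>The first positive coordinate. It may be \<open>n\<close>, in which case
    \<open>xs\<close> is empty and \<open>h\<close> is the vector of the empty set.\<close>
  define p where "p = (LEAST i. h i > 0)"
  have hn0: "h n > 0" using hn nn[of "n - 1"] by simp
  have hp: "h p > 0" unfolding p_def by (rule LeastI[of _ n]) (rule hn0)
  have pn: "p \<le> n" unfolding p_def by (rule Least_le) (rule hn0)
  have p1: "p \<ge> 1" using hp vec by (cases p) (auto simp: vectors_def)
  have before: "h i = 0" if "i < p" for i
    using not_less_Least[of i "\<lambda>i. h i > 0"] that nn[of i] unfolding p_def by simp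
  have after: "h i > 0" if "p \<le> i" "i < n" for i
    using that
  proof (induction i rule: dec_induct)
    case (step i)
    then show ?case using incr[of i] p1 by simp
  qed (rule hp)
  have strict: "h i < h j" if "i < j" "p \<le> i" "j < n" for i j
    using that
  proof (induction j)
    case (Suc j)
    then have "h j < h (j + 1)" using incr[of j] after[of j] p1 by simp
    with Suc show ?case by (cases "i = j") auto
  qed simp
  define xs where "xs = map (\<lambda>i. nat (h i)) [p..<n]"
  have "sorted_wrt (<) xs"
    unfolding xs_def sorted_wrt_map sorted_wrt_iff_nth_less
    using strict after nn by (auto simp: nat_less_eq_zless)
  then have xs: "sorted_list_of_set (set xs) = xs"
    by (simp add: strict_sorted_iff sorted_list_of_set.idem_if_sorted_distinct)
  have card: "card (set xs) = n - p"
    using \<open>sorted_wrt (<) xs\<close> distinct_card[of xs] by (simp add: strict_sorted_iff) (simp add: xs_def)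
  have A: "set xs \<subseteq> {1..n - 2}"
  proof
    fix a assume "a \<in> set xs"
    then obtain i where i: "p \<le> i" "i < n" "a = nat (h i)" by (auto simp: xs_def)
    then show "a \<in> {1..n - 2}" using after[OF i(1,2)] staircase_le[OF assms(2), of i] p1 by auto
  qed
  have lt: "v_vec n (set xs) i = h i" if "i < n" for i
  proof (cases "i < p")
    case True
    then show ?thesis using v_vec_nth[OF assms(1) A that] before pn by (simp add: card)
  next
    case False
    then show ?thesis
      using v_vec_nth[OF assms(1) A that, unfolded card xs] that pn nn by (simp add: xs_def)
  qed
  have "v_vec n (set xs) i = h i" for i
  proof (cases "i < n")
    case False
    then show ?thesis
      using v_vec_last[OF assms(1) A] v_vec_in_vectors[OF assms(1) A] lt[of "n - 1"] hn vec assms(1)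
      by (cases "i = n") (auto simp: vectors_def)
  qed (rule lt)
  then have "h = v_vec n (set xs)" by auto
  with A show ?thesis by blast
qed

text \<open>At a positive entry the difference is at least 1, so the right side is at least s_i =
  k(i - 1) + 1, which exceeds k(i - 1) and hence the left side. At a zero entry nonnegativity
  suffices.\<close>

lemma staircase_lecture_hall:
  assumes "n \<ge> 2" "staircase n h"
  shows "h \<in> lecture_hall_semigroup k n"
  unfolding lecture_hall_semigroup_iff
proof (intro conjI ballI)
  show "h \<in> vectors n" "0 \<le> h 1" using assms unfolding staircase_def by auto
  fix i assume "i \<in> {1..<n}"
  then have i: "1 \<le> i" "i < n" by auto
  have le: "h i \<le> int i - 1" using staircase_le[OF assms(2) i] .
  have nn: "0 \<le> h i" "0 \<le> h (i + 1)" using assms unfolding staircase_def by auto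
  show "int k * h i \<le> int (s_seq k i) * (h (i + 1) - h i)"
  proof (cases "h i = 0")
    case True
    then show ?thesis using nn by simp
  next
    case False
    have "h i + 1 \<le> h (i + 1)"
    proof (cases "i + 1 = n")
      case True
      then have "i = n - 1" by simp
      then show ?thesis using assms True unfolding staircase_def by simp
    next
      assume "i + 1 \<noteq> n"
      then have "i + 1 < n" using i by simp
      then have "h i < h (i + 1)"
        using assms(2) i False nn unfolding staircase_def by (metis less_le)
      then show ?thesis by simp
    qed
    then have "int (s_seq k i) * 1 \<le> int (s_seq k i) * (h (i + 1) - h i)"
      by (intro mult_left_mono) auto
    moreover have "int k * h i \<le> int k * (int i - 1)"
      using le by (intro mult_left_mono) auto
    moreover have "int (s_seq k i) = int k * (int i - 1) + 1"
      using i by (simp add: s_seq_def of_nat_diff algebra_simps)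
    ultimately show ?thesis by linarith
  qed
qed

section \<open>Two truncations that split off an element of the basis\<close>

text \<open>In terms of the ratio r = x_i / s_i, the two parts have ratios min(r, 1) and max(r - 1,
  0). Both are nondecreasing functions of r, so both parts inherit the chain of
  inequalities.\<close>

lemma lecture_hall_diff_min_s_seq:
  assumes x: "x \<in> lecture_hall_semigroup k n"
  defines "w \<equiv> \<lambda>i. if i \<in> {1..n} then min (x i) (int (s_seq k i)) else 0"
  shows "w \<in> lecture_hall_semigroup k n" "(\<lambda>i. x i - w i) \<in> lecture_hall_semigroup k n"
proof -
  have key: "int k * w i \<le> int (s_seq k i) * (w (i + 1) - w i)
     \<and> int k * (x i - w i) \<le> int (s_seq k i) * ((x (i + 1) - w (i + 1)) - (x i - w i))"
    if i: "i \<in> {1..<n}" for i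
  proof -
    have s: "int (s_seq k (i + 1)) = int (s_seq k i) + int k" using s_seq_Suc i by simp
    have w: "w i = min (x i) (int (s_seq k i))" "w (i + 1) = min (x (i + 1)) (int (s_seq k i) + int k)"
      using i unfolding w_def s by auto
    have st: "int k * x i \<le> int (s_seq k i) * (x (i + 1) - x i)"
      using lecture_hall_step[OF x] i by simp
    show ?thesis
    proof (cases "x i < int (s_seq k i)")
      case True
      have "int k * x i \<le> int (s_seq k i) * (int (s_seq k i) + int k - x i)"
      proof -
        have "int (s_seq k i + k) * x i \<le> int (s_seq k i + k) * int (s_seq k i)"
          using True by (intro mult_left_mono) auto
        then show ?thesis by (simp add: algebra_simps)
      qed
      moreover have "0 \<le> int (s_seq k i) * (x (i + 1) - w (i + 1))"
        unfolding w by (intro mult_nonneg_nonneg) auto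
      ultimately show ?thesis using True st unfolding w by (auto simp: min_def algebra_simps)
    next
      case False
      have "int k * int (s_seq k i) \<le> int k * x i" using False by (intro mult_left_mono) auto
      then have "int k * int (s_seq k i) \<le> int (s_seq k i) * (x (i + 1) - x i)" using st by linarith
      then have "int k \<le> x (i + 1) - x i" by (simp add: mult.commute)
      then have "w i = int (s_seq k i)" "w (i + 1) = int (s_seq k i) + int k"
        using False unfolding w by auto
      then show ?thesis using st by (simp add: algebra_simps)
    qed
  qed
  have "0 \<le> x 1" using lecture_hall_nonneg[OF x] .
  then show "w \<in> lecture_hall_semigroup k n" "(\<lambda>i. x i - w i) \<in> lecture_hall_semigroup k n"
    using key lecture_hall_outside[OF x]
    unfolding lecture_hall_semigroup_iff by (auto simp: w_def vectors_def)
qed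

text \<open>
  The conclusion is x i / (i - 1) \<le> x (i + 1) / i with denominators cleared: at small integer
  points, s i may be replaced by i - 1.
\<close>

lemma lecture_hall_small_step:
  assumes x: "x \<in> lecture_hall_semigroup k n" and i: "1 \<le> i" "i < n"
    and small: "x i < int (s_seq k i)"
  shows "x i \<le> (int i - 1) * (x (i + 1) - x i)"
proof (rule ccontr)
  define D where "D = x (i + 1) - x i"
  assume "\<not> ?thesis"
  \<comment> \<open>Integrality enters here: the strict inequality is sharpened by 1.\<close>
  then have c: "(int i - 1) * D + 1 \<le> x i" by (simp add: D_def)
  have s: "int (s_seq k i) = (int i - 1) * int k + 1"
    using i by (simp add: s_seq_def of_nat_diff)
  have "int k * ((int i - 1) * D + 1) \<le> int k * x i" using c by (intro mult_left_mono) auto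
  also have "\<dots> \<le> ((int i - 1) * int k + 1) * D"
    using lecture_hall_step[OF x i] unfolding s D_def .
  \<comment> \<open>The terms (i - 1) * k * D cancel. Inserting \<open>k \<le> D\<close> into
    \<open>c\<close> then gives x_i at least s_i, against \<open>small\<close>.\<close>
  finally have "int k \<le> D" by (simp add: algebra_simps)
  then have "(int i - 1) * int k \<le> (int i - 1) * D" using i by (intro mult_left_mono) auto
  with c s small show False by linarith
qed

text \<open>Converse passage from the sequence 0, 1, ..., n - 1 back to s: since s_i = k(i - 1) + 1,
  the lecture hall inequality is \<open>k\<close> times the small one plus nonnegativity of the
  difference.\<close>

lemma lecture_hall_if_small_step:
  assumes "y \<in> vectors n" "\<And>i. 0 \<le> y i"
    and "\<And>i. 1 \<le> i \<Longrightarrow> i < n \<Longrightarrow> y i \<le> (int i - 1) * (y (i + 1) - y i)"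
  shows "y \<in> lecture_hall_semigroup k n"
  unfolding lecture_hall_semigroup_iff
proof (intro conjI ballI)
  fix i assume "i \<in> {1..<n}"
  then have i: "1 \<le> i" "i < n" by auto
  let ?D = "y (i + 1) - y i"
  have st: "y i \<le> (int i - 1) * ?D" using assms(3)[OF i] .
  have "0 \<le> ?D"
  proof (rule ccontr)
    assume "\<not> 0 \<le> ?D"
    then have "(int i - 1) * ?D \<le> 0" using i by (simp add: mult_nonneg_nonpos)
    with st assms(2)[of i] assms(2)[of "i+1"] \<open>\<not> 0 \<le> ?D\<close> show False by linarith
  qed
  moreover have "int k * y i \<le> int k * ((int i - 1) * ?D)" using st by (intro mult_left_mono) auto
  moreover have "int (s_seq k i) * ?D = int k * ((int i - 1) * ?D) + ?D"
    using i by (simp add: s_seq_def of_nat_diff algebra_simps)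
  ultimately show "int k * y i \<le> int (s_seq k i) * ?D" by linarith
qed (use assms in auto)

lemma lecture_hall_small_diff_staircase:
  assumes "k \<ge> 1" "n \<ge> 2" and x: "x \<in> lecture_hall_semigroup k n" and "x \<noteq> (\<lambda>_. 0)"
    and small: "x (n - 1) < int (s_seq k (n - 1))"
  shows "\<exists>h. staircase n h \<and> (\<lambda>i. x i - h i) \<in> lecture_hall_semigroup k n"
proof -
  \<comment> \<open>The last entry is not a truncation of \<open>x n\<close>: it is forced to exceed
    the previous entry by exactly 1, as for every v_A.\<close>
  define h where "h = (\<lambda>i. if i \<in> {1..<n} then min (x i) (int i - 1)
                         else if i = n then min (x (n - 1)) (int n - 2) + 1 else 0)"
  have nn: "0 \<le> x i" for i by (rule lecture_hall_nonneg[OF x])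
  have sm: "x i \<le> (int i - 1) * (x (i + 1) - x i)" if "1 \<le> i" "i < n" for i
  proof (rule lecture_hall_small_step[OF x that])
    show "x i < int (s_seq k i)" by (rule lecture_hall_lt_s_seq[OF x that(1) _ _ small]) (use that in auto)
  qed
  have hn: "h n = h (n - 1) + 1" using assms(2) by (auto simp: h_def of_nat_diff)
  have stair: "staircase n h"
    unfolding staircase_def
  proof (intro conjI allI impI)
    show "h \<in> vectors n" using assms(2) by (auto simp: vectors_def h_def)
    show "0 \<le> h i" for i using nn assms(2) by (auto simp: h_def)
    show "h (n - 1) \<le> int n - 2" using assms(2) by (auto simp: h_def of_nat_diff)
    show "h n = h (n - 1) + 1" by (rule hn)
    fix i assume i: "1 \<le> i" "i + 1 < n" "0 < h i"
    then have "x i > 0" by (auto simp: h_def)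
    then have "x i < x (i + 1)" using lecture_hall_strict[OF x assms(1)] i by simp
    then show "h i < h (i + 1)" using i by (auto simp: h_def)
  qed
  have rest: "(\<lambda>i. x i - h i) \<in> lecture_hall_semigroup k n"
  proof (rule lecture_hall_if_small_step)
    show "(\<lambda>i. x i - h i) \<in> vectors n"
      using lecture_hall_outside[OF x] assms(2) by (auto simp: vectors_def h_def)
    \<comment> \<open>This gives \<open>h n \<le> x (n - 1) + 1 \<le> x n\<close>, so the remainder
      is nonnegative at \<open>n\<close> too.\<close>
    have lastd: "x (n - 1) < x n" by (rule lecture_hall_last_difference[OF x assms(1,2,4)])
    show "0 \<le> x i - h i" for i
      using nn lastd by (auto simp: h_def min_def)
    fix i assume i: "1 \<le> i" "i < n"
    have st: "x i \<le> (int i - 1) * (x (i + 1) - x i)" by (rule sm[OF i])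
    show "x i - h i \<le> (int i - 1) * ((x (i + 1) - h (i + 1)) - (x i - h i))"
    proof (cases "x i \<le> int i - 1")
      case True
      \<comment> \<open>The remainder vanishes at \<open>i\<close>, so only its nonnegativity at
        \<open>i + 1\<close> is at stake.\<close>
      then have "h i = x i" using i by (simp add: h_def)
      moreover have "h (i + 1) \<le> x (i + 1)"
        using nn lastd by (auto simp: h_def min_def)
      ultimately show ?thesis using i by simp
    next
      case False
      then have hi: "h i = int i - 1" using i by (simp add: h_def)
      \<comment> \<open>Subtracting \<open>h\<close> lowers the difference by at most 1, so the
        right side drops by at most \<open>i - 1\<close>, which is exactly the drop on the
        left.\<close>
      have "h (i + 1) \<le> int i"
        using i by (cases "i + 1 = n") (auto simp: h_def)
      then have "x (i + 1) - int i - (x i - (int i - 1)) \<le> (x (i + 1) - h (i + 1)) - (x i - h i)"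
        using hi by simp
      then have "(int i - 1) * (x (i + 1) - int i - (x i - (int i - 1)))
          \<le> (int i - 1) * ((x (i + 1) - h (i + 1)) - (x i - h i))"
        using i by (intro mult_left_mono) auto
      moreover have "(int i - 1) * (x (i + 1) - int i - (x i - (int i - 1)))
          = (int i - 1) * (x (i + 1) - x i) - (int i - 1)" by (simp add: algebra_simps)
      ultimately show ?thesis using st hi by linarith
    qed
  qed
  from stair rest show ?thesis by blast
qed

section \<open>Descent and irreducibility combined into the Hilbert basis\<close>

theorem theorem3p1:
  fixes k n :: nat
  assumes "k \<ge> 1" and "n \<ge> 2"
  defines "H \<equiv> {v_vec n A | A. A \<subseteq> {1..n - 2}} \<union>
      {w \<in> lecture_hall_semigroup k n.
         w (n - 1) = (int n - 2) * int k + 1 \<and> w n = (int n - 1) * int k + 1}"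
  shows "is_hilbert_basis (lecture_hall_semigroup k n) H \<and>
         is_hilbert_basis (integer_points (lecture_hall_cone k n)) H"
proof -
  let ?L = "lecture_hall_semigroup k n"
  have s: "int (s_seq k (n - 1)) = (int n - 2) * int k + 1" "int (s_seq k n) = (int n - 1) * int k + 1"
    using assms(2) by (auto simp: s_seq_def of_nat_diff)
  have H: "h \<in> H \<longleftrightarrow> staircase n h \<or>
      h \<in> ?L \<and> h (n - 1) = int (s_seq k (n - 1)) \<and> h n = int (s_seq k n)" for h
    unfolding H_def s using staircase_v_vec[OF assms(2)] v_vec_if_staircase[OF assms(2)] by blast
  have HL: "H \<subseteq> ?L" using H staircase_lecture_hall[OF assms(2)] by blast
  have pos: "0 < h n" if "h \<in> H" for h
    using that unfolding H staircase_def
    by (metis add_nonneg_pos of_nat_0_less_iff s_seq_pos(1) zero_less_one)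
  have "is_hilbert_basis ?L H"
  proof (rule is_hilbert_basisI[OF lecture_hall_zero lecture_hall_add HL])
    show "?L \<subseteq> nat_combinations H"
    \<comment> \<open>The last coordinate serves as measure because every element of
      \<open>H\<close> is positive there.\<close>
    proof (rule subset_nat_combinations_descent[where \<mu> = "\<lambda>x. nat (x n)"])
      fix x assume x: "x \<in> ?L" "x \<noteq> (\<lambda>_. 0)"
      have "\<exists>h\<in>H. (\<lambda>i. x i - h i) \<in> ?L"
      proof (cases "x (n - 1) < int (s_seq k (n - 1))")
        case True
        from lecture_hall_small_diff_staircase[OF assms(1,2) x True] H show ?thesis by blast
      next
        case False
        let ?w = "\<lambda>i. if i \<in> {1..n} then min (x i) (int (s_seq k i)) else 0"
        \<comment> \<open>Since x_{n-1} reaches s_{n-1}, also x_n reaches s_n, so the minimum has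
          the prescribed last two coordinates.\<close>
        have "\<not> x n < int (s_seq k n)"
          using lecture_hall_lt_s_seq[OF x(1), of "n - 1" n] False assms(2) by fastforce
        then have "?w \<in> H"
          unfolding H using lecture_hall_diff_min_s_seq(1)[OF x(1)] False assms(2) by auto
        then show ?thesis using lecture_hall_diff_min_s_seq(2)[OF x(1)] by (intro bexI[of _ ?w])
      qed
      then obtain h where h: "h \<in> H" "(\<lambda>i. x i - h i) \<in> ?L" by blast
      then have "nat (x n - h n) < nat (x n)"
        using pos[OF h(1)] lecture_hall_last_pos[OF x] by simp
      with h show "\<exists>h\<in>H. (\<lambda>i. x i - h i) \<in> ?L \<and> nat (x n - h n) < nat (x n)" by blast
    qed
    show "(\<lambda>_. 0) \<notin> H" using pos by fastforce
    fix h x y assume h: "h \<in> H" "x \<in> ?L" "y \<in> ?L" "h = (\<lambda>i. x i + y i)"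
    from h(1) consider "staircase n h" | "h (n - 1) = int (s_seq k (n - 1))" "h n = int (s_seq k n)"
      unfolding H by blast
    then show "x = (\<lambda>_. 0) \<or> y = (\<lambda>_. 0)"
    proof cases
      case 1
      then have "x n + y n = x (n - 1) + y (n - 1) + 1" using h(4) by (simp add: staircase_def)
      then show ?thesis
        using lecture_hall_last_difference[OF h(2) assms(1,2)]
          lecture_hall_last_difference[OF h(3) assms(1,2)] by linarith
    next
      case 2
      then show ?thesis using lecture_hall_w_irreducible[OF assms(2) h(2,3)] h(4) by simp
    qed
  qed
  then show ?thesis by (simp add: lecture_hall_semigroup_eq_integer_points)
qed

end
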